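(* Let $0<q<1$. For every positive integer $n$ and every $w\in\mathfrak h^0$, $\widehat\zeta[\partial_n(w)]=0$.
   Context: Fix $0<q<1$, $[x]_q := (1-q^x)/(1-q)$, and for positive integers $s_1,\dots,s_m$ with $s_1>1$ let $\zeta[s_1,\dots,s_m] := \sum_{k_1>\cdots>k_m>0}\prod_j q^{(s_j-1)k_j}/[k_j]_q^{s_j}$ (sum over positive integers), $\zeta[\,]:=1$. Let $\mathfrak h=\mathbf Q\langle x,y\rangle$ be the non-commutative polynomial algebra over $\mathbf Q$ in $x,y$, and $\mathfrak h^0=\mathbf Q1\oplus x\mathfrak h y$. Let $\widehat\zeta:\mathfrak h^0\to\mathbf R$ be the $\mathbf Q$-linear map with $\widehat\zeta[1]=1$ and $\widehat\zeta[x^{s_1-1}y\,x^{s_2-1}y\cdots x^{s_m-1}y]=\zeta[s_1,\dots,s_m]$ for positive integers $s_j$ with $s_1\ge2$. For a positive integer $n$, $\partial_n$ is the derivation of $\mathfrak h$ (a $\mathbf Q$-linear map satisfying the Leibniz rule) determined by $\partial_n(x)=x(x+y)^{n-1}y$ and $\partial_n(y)=-x(x+y)^{n-1}y$. *)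

theory Defs
  imports "HOL-Analysis.Analysis"
begin

datatype letter = X | Y

(* Elements of h = Q<x,y> are represented by their coefficient functions
   word => rat; genuine elements are those with finite support. *)
type_synonym ncpoly = "letter list \<Rightarrow> rat"

definition supp :: "ncpoly \<Rightarrow> letter list set" where
  "supp P = {w. P w \<noteq> 0}"

definition in_h :: "ncpoly \<Rightarrow> bool" where
  "in_h P \<longleftrightarrow> finite (supp P)"

definition in_h0 :: "ncpoly \<Rightarrow> bool" where
  "in_h0 P \<longleftrightarrow> in_h P \<and>
     (\<forall>w\<in>supp P. w = [] \<or> (w \<noteq> [] \<and> hd w = X \<and> last w = Y))"

definition mon :: "letter list \<Rightarrow> ncpoly" where
  "mon w = (\<lambda>u. if u = w then 1 else 0)"

definition pmul :: "ncpoly \<Rightarrow> ncpoly \<Rightarrow> ncpoly" where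
  "pmul P Q = (\<lambda>u. \<Sum>i\<le>length u. P (take i u) * Q (drop i u))"

fun ppow :: "ncpoly \<Rightarrow> nat \<Rightarrow> ncpoly" where
  "ppow P 0 = mon []"
| "ppow P (Suc k) = pmul P (ppow P k)"

definition xx :: ncpoly where "xx = mon [X]"
definition yy :: ncpoly where "yy = mon [Y]"

definition dgen :: "nat \<Rightarrow> letter \<Rightarrow> ncpoly" where
  "dgen n a = (let D = pmul (pmul xx (ppow (\<lambda>u. xx u + yy u) (n - 1))) yy
               in if a = X then D else (\<lambda>u. - D u))"

(* extension to words via the Leibniz rule *)
fun dword :: "nat \<Rightarrow> letter list \<Rightarrow> ncpoly" where
  "dword n [] = (\<lambda>u. 0)"
| "dword n (a # w) = (\<lambda>u. pmul (dgen n a) (mon w) u + pmul (mon [a]) (dword n w) u)"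

definition dn :: "nat \<Rightarrow> ncpoly \<Rightarrow> ncpoly" where
  "dn n P = (\<lambda>u. \<Sum>w\<in>supp P. P w * dword n w u)"

definition qint :: "real \<Rightarrow> nat \<Rightarrow> real" where
  "qint q k = (1 - q ^ k) / (1 - q)"

definition qzeta :: "real \<Rightarrow> nat list \<Rightarrow> real" where
  "qzeta q s = infsum
     (\<lambda>ks. \<Prod>j<length s. q ^ ((s ! j - 1) * ks ! j) / qint q (ks ! j) ^ (s ! j))
     {ks. length ks = length s \<and> sorted_wrt (>) ks \<and> (\<forall>k\<in>set ks. k > 0)}"

(* index list of a word x^{s1-1} y ... x^{sm-1} y; c counts the pending x's *)
fun idx :: "letter list \<Rightarrow> nat \<Rightarrow> nat list" where
  "idx [] c = []"
| "idx (X # w) c = idx w (Suc c)"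
| "idx (Y # w) c = Suc c # idx w 0"

definition zhat :: "real \<Rightarrow> ncpoly \<Rightarrow> real" where
  "zhat q P = (\<Sum>w\<in>supp P. real_of_rat (P w) * qzeta q (idx w 0))"

end

theory Submission
  imports Defs
begin

text \<open>
  Put \<open>p\<^sub>k = q\<^sup>k / [k]\<close>. Let \<open>x\<close> act on sequences as multiplication by \<open>p\<close> and let \<open>y\<close> send \<open>f\<close>
  to the sequence of the \<open>(\<Sum>j<k. f j) / [k]\<close>; then \<open>\<zeta>[w]\<close> is the sum of the entries of \<open>w\<close> applied to
  the unit sequence at 0. A lower triangular matrix \<open>V\<close> conjugates \<open>x + y\<close> to multiplication by
  \<open>p\<close> and \<open>x\<close> to the map \<open>g \<mapsto> (\<Sum>1\<le>j\<le>k. p\<^sub>j g\<^sub>j)\<close>. In these coordinates the derivation is the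
  commutator with the diagonal matrix \<open>\<phi>\<close> whose entries are \<open>- (\<Sum>1\<le>j\<le>k. p\<^sub>j ^ n)\<close>, and a derived
  word applied to the unit sequence becomes \<open>H f\<close>, with \<open>H = V \<phi> V\<^sup>-\<^sup>1\<close> and \<open>f\<close> the undifferentiated
  word applied to it. Since \<open>H\<close> commutes with \<open>Z = x + y\<close> and its entries decay geometrically away
  from the diagonal, the partial sums of \<open>H f\<close>, which are \<open>[N+1]\<close> times the entries of
  \<open>y H f = H Z f - x H f\<close>, tend to 0.
\<close>

section \<open>Linear functionals on noncommutative polynomials\<close>

text \<open>\<open>zhat q\<close> is the instance given by the zeta values; \<open>poly_op\<close>
  uses the same extension for each entry of the sequences that words produce.\<close>

definition lin_ext :: "(letter list \<Rightarrow> real) \<Rightarrow> ncpoly \<Rightarrow> real" where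
  "lin_ext c P = (\<Sum>u\<in>supp P. of_rat (P u) * c u)"

lemma lin_ext_superset:
  assumes "finite S" "supp P \<subseteq> S"
  shows "lin_ext c P = (\<Sum>u\<in>S. of_rat (P u) * c u)"
  unfolding lin_ext_def using assms by (intro sum.mono_neutral_left) (auto simp: supp_def)

lemma supp_mon [simp]: "supp (mon w) = {w}"
  by (auto simp: supp_def mon_def)

lemma lin_ext_mon [simp]: "lin_ext c (mon w) = c w"
  unfolding lin_ext_def supp_mon by (simp add: mon_def)

lemma supp_add: "supp (\<lambda>u. P u + Q u) \<subseteq> supp P \<union> supp Q"
  by (auto simp: supp_def)

lemma supp_uminus [simp]: "supp (\<lambda>u. - P u) = supp P"
  by (auto simp: supp_def)

lemma lin_ext_add:
  assumes "finite (supp P)" "finite (supp Q)"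
  shows "lin_ext c (\<lambda>u. P u + Q u) = lin_ext c P + lin_ext c Q"
  using assms lin_ext_superset[of "supp P \<union> supp Q" _ c] supp_add[of P Q]
  by (simp add: of_rat_add distrib_right sum.distrib)

lemma lin_ext_uminus: "lin_ext c (\<lambda>u. - P u) = - lin_ext c P"
  by (simp add: lin_ext_def of_rat_minus sum_negf)

lemma lin_ext_sum:
  assumes "finite S" "\<And>i. i \<in> S \<Longrightarrow> finite (supp (P i))"
  shows "lin_ext c (\<lambda>u. \<Sum>i\<in>S. r i * P i u) = (\<Sum>i\<in>S. of_rat (r i) * lin_ext c (P i))"
proof -
  let ?U = "\<Union>i\<in>S. supp (P i)"
  have fin: "finite ?U" using assms by blast
  have "supp (\<lambda>u. \<Sum>i\<in>S. r i * P i u) \<subseteq> ?U"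
    by (force simp: supp_def intro: sum.neutral)
  then have "lin_ext c (\<lambda>u. \<Sum>i\<in>S. r i * P i u) = (\<Sum>u\<in>?U. of_rat (\<Sum>i\<in>S. r i * P i u) * c u)"
    by (rule lin_ext_superset[OF fin])
  also have "\<dots> = (\<Sum>u\<in>?U. \<Sum>i\<in>S. of_rat (r i) * (of_rat (P i u) * c u))"
    by (simp add: of_rat_sum of_rat_mult sum_distrib_right mult.assoc)
  also have "\<dots> = (\<Sum>i\<in>S. \<Sum>u\<in>?U. of_rat (r i) * (of_rat (P i u) * c u))"
    by (rule sum.swap)
  also have "\<dots> = (\<Sum>i\<in>S. of_rat (r i) * lin_ext c (P i))"
    using fin by (intro sum.cong refl) (subst lin_ext_superset[of ?U], auto simp: sum_distrib_left)
  finally show ?thesis .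
qed

lemma tendsto_lin_ext:
  assumes "\<And>u. u \<in> supp P \<Longrightarrow> (\<lambda>N. c N u) \<longlonglongrightarrow> d u"
  shows "(\<lambda>N. lin_ext (c N) P) \<longlonglongrightarrow> lin_ext d P"
  unfolding lin_ext_def using assms by (intro tendsto_intros) auto

text \<open>Cutting u at a position i is the same as choosing a pair with \<open>a @ b = u\<close>.
  Over pairs the two supports separate.\<close>

lemma pmul_alt:
  assumes "finite (supp P)" "finite (supp Q)"
  shows "pmul P Q u = (\<Sum>(a, b) \<in> supp P \<times> supp Q. if a @ b = u then P a * Q b else 0)"
proof -
  let ?D = "{(a, b). a @ b = u}"
  have bij: "bij_betw (\<lambda>i. (take i u, drop i u)) {..length u} ?D"
    by (rule bij_betw_byWitness[where f' = "\<lambda>(a, b). length a"]) auto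
  then have fin: "finite ?D" using bij_betw_finite by blast
  have "pmul P Q u = (\<Sum>(a, b) \<in> ?D. P a * Q b)"
    unfolding pmul_def using sum.reindex_bij_betw[OF bij, of "\<lambda>(a, b). P a * Q b"] by simp
  also have "\<dots> = (\<Sum>(a, b) \<in> ?D \<inter> supp P \<times> supp Q. P a * Q b)"
    using fin by (intro sum.mono_neutral_right) (auto simp: supp_def)
  also have "\<dots> = (\<Sum>(a, b) \<in> supp P \<times> supp Q. if a @ b = u then P a * Q b else 0)"
    using assms by (intro sum.mono_neutral_cong_left) (auto split: if_splits)
  finally show ?thesis .
qed

lemma supp_pmul: "supp (pmul P Q) \<subseteq> (\<lambda>(a, b). a @ b) ` (supp P \<times> supp Q)"
proof
  fix u assume "u \<in> supp (pmul P Q)"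
  then obtain i where "P (take i u) * Q (drop i u) \<noteq> 0"
    unfolding supp_def pmul_def using sum.not_neutral_contains_not_neutral by blast
  then show "u \<in> (\<lambda>(a, b). a @ b) ` (supp P \<times> supp Q)"
    by (intro image_eqI[of _ _ "(take i u, drop i u)"]) (auto simp: supp_def)
qed

lemma finite_supp_pmul:
  "finite (supp P) \<Longrightarrow> finite (supp Q) \<Longrightarrow> finite (supp (pmul P Q))"
  using supp_pmul finite_subset by (metis finite_SigmaI finite_imageI)

text \<open>Once the sum over pairs is outermost, each pair of monomials meets only the word
  \<open>a @ b\<close>. This is what makes \<open>poly_op\<close> multiplicative.\<close>

lemma lin_ext_pmul:
  assumes "finite (supp P)" "finite (supp Q)"
  shows "lin_ext c (pmul P Q) = lin_ext (\<lambda>u. lin_ext (\<lambda>v. c (u @ v)) Q) P"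
proof -
  let ?T = "supp P \<times> supp Q"
  let ?S = "(\<lambda>(a, b). a @ b) ` ?T"
  have fin: "finite ?S" "finite ?T" using assms by auto
  have "lin_ext c (pmul P Q) = (\<Sum>u\<in>?S. of_rat (pmul P Q u) * c u)"
    by (rule lin_ext_superset[OF fin(1) supp_pmul])
  also have "\<dots> = (\<Sum>u\<in>?S. \<Sum>(a, b)\<in>?T. if a @ b = u then of_rat (P a * Q b) * c (a @ b) else 0)"
    unfolding pmul_alt[OF assms] of_rat_sum sum_distrib_right
    by (intro sum.cong refl) auto
  also have "\<dots> = (\<Sum>(a, b)\<in>?T. \<Sum>u\<in>?S. if a @ b = u then of_rat (P a * Q b) * c (a @ b) else 0)"
    by (subst sum.swap) (simp add: case_prod_unfold)
  also have "\<dots> = (\<Sum>(a, b)\<in>?T. of_rat (P a * Q b) * c (a @ b))"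
    using fin by (intro sum.cong refl) (auto simp: sum.delta')
  also have "\<dots> = lin_ext (\<lambda>u. lin_ext (\<lambda>v. c (u @ v)) Q) P"
    unfolding lin_ext_def
    by (simp add: sum.cartesian_product[symmetric] sum_distrib_left of_rat_mult mult.assoc)
  finally show ?thesis .
qed

lemma finite_supp_ppow: "finite (supp P) \<Longrightarrow> finite (supp (ppow P k))"
  by (induction k) (auto intro: finite_supp_pmul)

lemma supp_xx [simp]: "supp xx = {[X]}" and supp_yy [simp]: "supp yy = {[Y]}"
  by (simp_all add: xx_def yy_def)

lemma finite_supp_xx_plus_yy: "finite (supp (\<lambda>u. xx u + yy u))"
proof (rule finite_subset[OF supp_add])
  show "finite (supp xx \<union> supp yy)" by simp
qed

lemma finite_supp_dgen: "finite (supp (dgen n a))"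
  unfolding dgen_def Let_def
  by (auto intro!: finite_supp_pmul finite_supp_ppow finite_supp_xx_plus_yy)

lemma finite_supp_dword: "finite (supp (dword n w))"
proof (induction w)
  case Nil
  then show ?case by (simp add: supp_def)
next
  case (Cons a w)
  then show ?case
    by (auto intro!: finite_subset[OF supp_add] finite_supp_pmul finite_supp_dgen)
qed

section \<open>Shape of the monomials in a derived word\<close>

lemma supp_dgen:
  assumes "u \<in> supp (dgen n a)"
  obtains v where "u = X # v @ [Y]"
proof -
  let ?Z = "ppow (\<lambda>u. xx u + yy u) (n - 1)"
  have "u \<in> supp (pmul (pmul xx ?Z) yy)"
    using assms by (auto simp: dgen_def Let_def split: if_splits)
  then obtain b where b: "b \<in> supp (pmul xx ?Z)" "u = b @ [Y]"
    using supp_pmul[of "pmul xx ?Z" yy] by auto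
  then obtain v where "b = X # v"
    using supp_pmul[of xx ?Z] by auto
  with b show thesis using that by simp
qed

lemma supp_dword_Cons:
  assumes "u \<in> supp (dword n (a # w))"
  obtains v where "u = X # v @ [Y] @ w" | v where "u = a # v" "v \<in> supp (dword n w)"
proof -
  from assms consider "u \<in> supp (pmul (dgen n a) (mon w))" | "u \<in> supp (pmul (mon [a]) (dword n w))"
    using supp_add by fastforce
  then show thesis
  proof cases
    case 1
    then obtain v where "v \<in> supp (dgen n a)" "u = v @ w"
      using supp_pmul[of "dgen n a" "mon w"] by auto
    then show thesis by (auto elim!: supp_dgen intro: that(1))
  next
    case 2
    then obtain v where "v \<in> supp (dword n w)" "u = [a] @ v"
      using supp_pmul[of "mon [a]" "dword n w"] by auto
    then show thesis by (auto intro: that(2))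
  qed
qed

text \<open>With \<open>hd_supp_dword\<close> this keeps derivatives of words x...y of the form
  x...y, where the zeta series converge. Either the final letter is replaced by something ending in
  y, or it survives.\<close>

lemma last_supp_dword:
  assumes "u \<in> supp (dword n w)" "last w = Y"
  shows "u \<noteq> [] \<and> last u = Y"
  using assms
proof (induction w arbitrary: u)
  case Nil
  then show ?case by (simp add: supp_def)
next
  case (Cons a w)
  from Cons.prems(1) show ?case
  proof (rule supp_dword_Cons)
    fix v assume "u = X # v @ [Y] @ w"
    then show ?thesis using Cons.prems(2) by (cases "w = []") auto
  next
    fix v assume v: "u = a # v" "v \<in> supp (dword n w)"
    \<comment> \<open>The empty word has derivative zero, so \<open>w\<close> still has a last
      letter.\<close>
    then have "w \<noteq> []" by (auto simp: supp_def)
    with v show ?thesis using Cons.IH[of v] Cons.prems(2) by auto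
  qed
qed

lemma hd_supp_dword:
  assumes "u \<in> supp (dword n w)" "hd w = X"
  shows "hd u = X"
proof (cases w)
  case Nil
  then show ?thesis using assms by (simp add: supp_def)
next
  case (Cons a v)
  show ?thesis
    using assms supp_dword_Cons[of u n a v "hd u = X"] unfolding Cons by auto
qed

section \<open>Sums along exhaustions, and polynomial against geometric growth\<close>

text \<open>For nonnegative terms every finite subset sum lies below some truncation, and every
  sufficiently large one above a given truncation. This links \<open>infsum\<close> to truncated
  zeta sums.\<close>

lemma has_sum_exhaustion:
  fixes f :: "'a \<Rightarrow> real"
  assumes nonneg: "\<And>x. x \<in> A \<Longrightarrow> f x \<ge> 0"
    and B: "mono B" "\<And>N. finite (B N)" "\<And>N. B N \<subseteq> A"
    and exhaust: "\<And>F. finite F \<Longrightarrow> F \<subseteq> A \<Longrightarrow> \<exists>N. F \<subseteq> B N"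
    and lim: "(\<lambda>N::nat. sum f (B N)) \<longlonglongrightarrow> l"
  shows "(f has_sum l) A"
  unfolding has_sum_def
proof (rule increasing_tendsto)
  have "incseq (\<lambda>N. sum f (B N))"
    using B nonneg incseq_SucD[OF B(1)] by (intro incseq_SucI sum_mono2) blast+
  then have le: "sum f (B N) \<le> l" for N
    using lim incseq_le by blast
  show "\<forall>\<^sub>F F in finite_subsets_at_top A. sum f F \<le> l"
  proof (rule eventually_finite_subsets_at_top_weakI)
    fix F assume F: "finite F" "F \<subseteq> A"
    then obtain N where "F \<subseteq> B N" using exhaust by blast
    then have "sum f F \<le> sum f (B N)"
      using B(2) B(3)[of N] nonneg by (intro sum_mono2) auto
    with le show "sum f F \<le> l" by (meson order_trans)
  qed
next
  fix y assume "y < l"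
  then obtain N where N: "y < sum f (B N)"
    using order_tendstoD(1)[OF lim] by (auto simp: eventually_sequentially)
  have "\<forall>\<^sub>F F in finite_subsets_at_top A. finite F \<and> B N \<subseteq> F \<and> F \<subseteq> A"
    using B by (auto simp: eventually_finite_subsets_at_top)
  then show "\<forall>\<^sub>F F in finite_subsets_at_top A. y < sum f F"
  proof eventually_elim
    case (elim F)
    then have "sum f (B N) \<le> sum f F"
      using nonneg by (intro sum_mono2) auto
    with N show ?case by linarith
  qed
qed

text \<open>With t the m-th root of s, the term is the m-th power of (k + 1) t^k, which tends to
  0.\<close>

lemma tendsto_poly_times_geometric:
  fixes s :: real
  assumes "0 < s" "s < 1"
  shows "(\<lambda>k. (real k + 1) ^ m * s ^ k) \<longlonglongrightarrow> 0"
proof (cases m)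
  case 0
  then show ?thesis using assms by (simp add: LIMSEQ_power_zero)
next
  case (Suc l)
  define t where "t = root m s"
  have t: "0 < t" "t < 1" "t ^ m = s"
    using assms Suc real_root_pow_pos2[of m s] by (simp_all add: t_def real_root_lt_1_iff del: power_Suc)
  have "(\<lambda>k. (real k * t ^ k + t ^ k) ^ m) \<longlonglongrightarrow> (0 + 0) ^ m"
    using t by (intro tendsto_intros powser_times_n_limit_0 LIMSEQ_power_zero) auto
  moreover have "(real k * t ^ k + t ^ k) ^ m = (real k + 1) ^ m * s ^ k" for k
    unfolding t(3)[symmetric] power_mult[symmetric]
    by (simp add: power_mult_distrib[symmetric] power_mult mult.commute[of m] algebra_simps)
  ultimately show ?thesis using Suc by simp
qed

section \<open>Triangular operators on sequences\<close>

definition linop :: "((nat \<Rightarrow> real) \<Rightarrow> nat \<Rightarrow> real) \<Rightarrow> bool" where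
  "linop T \<longleftrightarrow> (\<forall>f g. T (\<lambda>k. f k + g k) = (\<lambda>k. T f k + T g k)) \<and>
                (\<forall>c f. T (\<lambda>k. c * f k) = (\<lambda>k. c * T f k))"

lemma linop_add: "linop T \<Longrightarrow> T (\<lambda>k. f k + g k) = (\<lambda>k. T f k + T g k)"
  by (simp add: linop_def)

lemma linop_scale: "linop T \<Longrightarrow> T (\<lambda>k. c * f k) = (\<lambda>k. c * T f k)"
  by (simp add: linop_def)

lemma linop_zero: "linop T \<Longrightarrow> T (\<lambda>k. 0) = (\<lambda>k. 0)"
  using linop_scale[of T 0 "\<lambda>k. 0"] by simp

lemma linop_diff:
  assumes "linop T" shows "T (\<lambda>k. f k - g k) = (\<lambda>k. T f k - T g k)"
  using linop_add[OF assms, of f "\<lambda>k. (-1) * g k"] linop_scale[OF assms, of "-1" g] by simp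

lemma linop_sum:
  assumes "linop T"
  shows "T (\<lambda>k. \<Sum>i\<in>I. c i * f i k) = (\<lambda>k. \<Sum>i\<in>I. c i * T (f i) k)"
  by (induction I rule: infinite_finite_induct)
    (simp_all add: linop_zero[OF assms] linop_add[OF assms] linop_scale[OF assms])

lemma linop_compose: "linop S \<Longrightarrow> linop T \<Longrightarrow> linop (\<lambda>f. S (T f))"
  by (simp add: linop_def)

lemma linop_add_op: "linop S \<Longrightarrow> linop T \<Longrightarrow> linop (\<lambda>f k. S f k + T f k)"
  by (simp add: linop_def algebra_simps)

lemma linop_power: "linop T \<Longrightarrow> linop (T ^^ m)"
  by (induction m) (simp_all add: linop_def)

lemma linop_mult: "linop (\<lambda>f k. a k * f k)"
  by (simp add: linop_def algebra_simps)

lemma linop_kernel: "linop (\<lambda>f k. \<Sum>j\<in>S k. a k j * f j)"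
  by (simp add: linop_def algebra_simps sum.distrib sum_distrib_left)

text \<open>Lower triangularity without a matrix: each row sees finitely many entries, so no
  convergence question arises when operators are composed.\<close>

definition lower :: "((nat \<Rightarrow> real) \<Rightarrow> nat \<Rightarrow> real) \<Rightarrow> bool" where
  "lower T \<longleftrightarrow> (\<forall>f g k. (\<forall>j\<le>k. f j = g j) \<longrightarrow> T f k = T g k)"

lemma lowerD: "lower T \<Longrightarrow> (\<And>j. j \<le> k \<Longrightarrow> f j = g j) \<Longrightarrow> T f k = T g k"
  by (simp add: lower_def)

lemma lower_power: "lower T \<Longrightarrow> lower (T ^^ m)"
  by (induction m) (auto simp: lower_def)

definition unit_seq :: "nat \<Rightarrow> nat \<Rightarrow> real" where
  "unit_seq b k = (if k = b then 1 else 0)"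

lemma sum_unit_seq: "finite I \<Longrightarrow> (\<Sum>b\<in>I. f b * unit_seq b k) = (if k \<in> I then f k else 0)"
  by (simp add: unit_seq_def if_distrib sum.delta cong: if_cong)

section \<open>The q-integers and the sequence p\<close>

locale q_param =
  fixes q :: real
  assumes q_pos: "0 < q" and q_less_1: "q < 1"
begin

definition p :: "nat \<Rightarrow> real" where
  "p k = q ^ k / qint q k"

lemma qint_0 [simp]: "qint q 0 = 0"
  by (simp add: qint_def)

lemma p_0 [simp]: "p 0 = 0"
  by (simp add: p_def)

lemma qint_ge_1: "k > 0 \<Longrightarrow> qint q k \<ge> 1"
  using q_pos q_less_1 power_decreasing[of 1 k q] by (simp add: qint_def field_simps)

lemma qint_pos: "k > 0 \<Longrightarrow> qint q k > 0"
  using qint_ge_1[of k] by simp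

lemma qint_nonneg: "qint q k \<ge> 0"
  using qint_pos[of k] by (cases "k = 0") auto

lemma qint_le: "qint q k \<le> 1 / (1 - q)"
  using q_pos q_less_1 by (simp add: qint_def field_simps)

lemma p_pos: "k > 0 \<Longrightarrow> p k > 0"
  using qint_pos[of k] q_pos by (simp add: p_def)

lemma p_nonneg: "p k \<ge> 0"
  using p_pos[of k] by (cases "k = 0") auto

lemma p_le: "p k \<le> q ^ k"
  using qint_ge_1[of k] q_pos
  by (cases "k = 0") (auto simp: p_def divide_le_eq mult_le_cancel_left1)

lemma p_le_1: "p k \<le> 1"
  using p_le[of k] power_le_one[of q k] q_pos q_less_1 by linarith

text \<open>After cross-multiplication the terms q^(a+b) cancel. The factor q^b - q^a yields the
  strict decrease of p and the closed ratios in \<open>Vc_Suc\<close>.\<close>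

lemma p_diff:
  assumes "b > 0" "a > 0"
  shows "p b - p a = (q ^ b - q ^ a) / ((1 - q) * qint q a * qint q b)"
proof -
  have "q ^ b * qint q a - q ^ a * qint q b = (q ^ b - q ^ a) / (1 - q)"
    by (simp add: qint_def diff_divide_distrib[symmetric] algebra_simps)
  then have "p b - p a = (q ^ b - q ^ a) / (1 - q) / (qint q a * qint q b)"
    using qint_pos[OF assms(1)] qint_pos[OF assms(2)] by (simp add: p_def field_simps)
  then show ?thesis by (simp add: mult.assoc)
qed

lemma p_less: "b > 0 \<Longrightarrow> b < a \<Longrightarrow> p a < p b"
  using p_diff[of b a] qint_pos[of a] qint_pos[of b] q_less_1 power_strict_decreasing[of b a q] q_pos
  by (smt (verit) divide_pos_pos gr0I mult_pos_pos not_less_zero)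

section \<open>Words and polynomials as operators\<close>

text \<open>Division by \<open>[0] = 0\<close> gives 0, so both letters produce sequences vanishing at index 0, and only
  words ending in \<open>y\<close> are meaningful on the unit sequence at 0.\<close>

definition opX :: "(nat \<Rightarrow> real) \<Rightarrow> nat \<Rightarrow> real" where
  "opX f k = p k * f k"

definition opY :: "(nat \<Rightarrow> real) \<Rightarrow> nat \<Rightarrow> real" where
  "opY f k = (\<Sum>j<k. f j) / qint q k"

definition opZ :: "(nat \<Rightarrow> real) \<Rightarrow> nat \<Rightarrow> real" where
  "opZ f k = opX f k + opY f k"

fun letter_op :: "letter \<Rightarrow> (nat \<Rightarrow> real) \<Rightarrow> nat \<Rightarrow> real" where
  "letter_op X = opX"
| "letter_op Y = opY"

definition word_op :: "letter list \<Rightarrow> (nat \<Rightarrow> real) \<Rightarrow> nat \<Rightarrow> real" where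
  "word_op w = foldr letter_op w"

lemma word_op_simps [simp]:
  "word_op [] f = f"
  "word_op (a # w) f = letter_op a (word_op w f)"
  "word_op (u @ v) f = word_op u (word_op v f)"
  by (simp_all add: word_op_def)

lemma linop_opX: "linop opX"
  unfolding opX_def[abs_def] by (rule linop_mult)

lemma linop_opY: "linop opY"
  by (simp add: linop_def opY_def fun_eq_iff sum.distrib add_divide_distrib sum_distrib_left)

lemma linop_opZ: "linop opZ"
  unfolding opZ_def[abs_def] by (rule linop_add_op[OF linop_opX linop_opY])

lemma linop_letter_op: "linop (letter_op a)"
  by (cases a) (simp_all add: linop_opX linop_opY)

lemma linop_word_op: "linop (word_op w)"
  by (induction w) (auto simp: linop_def linop_add[OF linop_letter_op] linop_scale[OF linop_letter_op])

lemma lower_opZ: "lower opZ"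
  by (auto simp: lower_def opZ_def opX_def opY_def)

definition poly_op :: "ncpoly \<Rightarrow> (nat \<Rightarrow> real) \<Rightarrow> nat \<Rightarrow> real" where
  "poly_op P f k = lin_ext (\<lambda>u. word_op u f k) P"

lemma poly_op_mon [simp]: "poly_op (mon w) f = word_op w f"
  by (simp add: poly_op_def fun_eq_iff)

lemma poly_op_add:
  "finite (supp P) \<Longrightarrow> finite (supp Q) \<Longrightarrow>
    poly_op (\<lambda>u. P u + Q u) f = (\<lambda>k. poly_op P f k + poly_op Q f k)"
  by (simp add: poly_op_def lin_ext_add fun_eq_iff)

lemma poly_op_uminus: "poly_op (\<lambda>u. - P u) f = (\<lambda>k. - poly_op P f k)"
  by (simp add: poly_op_def lin_ext_uminus fun_eq_iff)

text \<open>Concatenation acts by composition, and linearity of \<open>word_op u\<close> lets it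
  pass through the combination of words in Q.\<close>

lemma poly_op_pmul:
  assumes "finite (supp P)" "finite (supp Q)"
  shows "poly_op (pmul P Q) f = poly_op P (poly_op Q f)"
proof
  fix k
  have "lin_ext (\<lambda>v. word_op (u @ v) f k) Q = word_op u (poly_op Q f) k" for u
    using linop_sum[OF linop_word_op, of u "\<lambda>v. of_rat (Q v)" "\<lambda>v. word_op v f" "supp Q"]
    by (simp add: poly_op_def[abs_def] lin_ext_def)
  then show "poly_op (pmul P Q) f k = poly_op P (poly_op Q f) k"
    unfolding poly_op_def[of "pmul P Q"] lin_ext_pmul[OF assms] by (simp add: poly_op_def[of P])
qed

lemma poly_op_ppow: "poly_op (ppow (\<lambda>u. xx u + yy u) m) f = (opZ ^^ m) f"
proof (induction m)
  case (Suc m)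
  have "poly_op (\<lambda>u. xx u + yy u) g = opZ g" for g
    by (simp add: poly_op_add xx_def yy_def opZ_def fun_eq_iff)
  then show ?case
    using Suc by (simp add: poly_op_pmul finite_supp_xx_plus_yy finite_supp_ppow)
qed simp

text \<open>The action of x (x + y)^(n-1) y, the image of x under the derivation.\<close>

definition deltaX :: "nat \<Rightarrow> (nat \<Rightarrow> real) \<Rightarrow> nat \<Rightarrow> real" where
  "deltaX n f = opX ((opZ ^^ (n - 1)) (opY f))"

lemma poly_op_dgen:
  "poly_op (dgen n X) f = deltaX n f"
  "poly_op (dgen n Y) f = (\<lambda>k. - deltaX n f k)"
proof -
  have "poly_op (pmul (pmul xx (ppow (\<lambda>u. xx u + yy u) (n - 1))) yy) f = deltaX n f"
    by (simp add: poly_op_pmul finite_supp_pmul finite_supp_ppow finite_supp_xx_plus_yy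
      poly_op_ppow deltaX_def) (simp add: xx_def yy_def)
  then show "poly_op (dgen n X) f = deltaX n f" "poly_op (dgen n Y) f = (\<lambda>k. - deltaX n f k)"
    by (simp_all add: dgen_def Let_def poly_op_uminus)
qed

lemma poly_op_zero [simp]: "poly_op (\<lambda>u. 0) f = (\<lambda>k. 0)"
  by (simp add: poly_op_def lin_ext_def supp_def fun_eq_iff)

lemma poly_op_dword_Cons:
  "poly_op (dword n (a # w)) f =
    (\<lambda>k. poly_op (dgen n a) (word_op w f) k + letter_op a (poly_op (dword n w) f) k)"
  by (simp add: poly_op_add poly_op_pmul finite_supp_pmul finite_supp_dgen finite_supp_dword)

section \<open>Coordinates that diagonalize x + y\<close>

text \<open>The letters in the coordinates given by the columns of \<open>Vc\<close> below. The entries of \<open>Vc\<close> are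
  determined by \<open>x V = V tX\<close> and \<open>V 1 = y (unit_seq 0)\<close>: the partial row sums \<open>Rc k b\<close>, over the columns from
  \<open>b\<close> on, satisfy \<open>p k * Vc k b = p b * Rc k b\<close>.\<close>

definition tX :: "(nat \<Rightarrow> real) \<Rightarrow> nat \<Rightarrow> real" where
  "tX g k = (\<Sum>j\<in>{1..k}. p j * g j)"

definition tY :: "(nat \<Rightarrow> real) \<Rightarrow> nat \<Rightarrow> real" where
  "tY g k = p k * g k - tX g k"

definition Rc :: "nat \<Rightarrow> nat \<Rightarrow> real" where
  "Rc k b = (\<Prod>j\<in>{1..<b}. 1 - p j / p k) / qint q k"

definition Vc :: "nat \<Rightarrow> nat \<Rightarrow> real" where
  "Vc k b = Rc k b * p b / p k"

definition opV :: "(nat \<Rightarrow> real) \<Rightarrow> nat \<Rightarrow> real" where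
  "opV g k = (\<Sum>b\<in>{1..k}. Vc k b * g b)"

lemma linop_opV: "linop opV"
  unfolding opV_def[abs_def] by (rule linop_kernel)

lemma opV_cong: "(\<And>b. b \<in> {1..k} \<Longrightarrow> g b = h b) \<Longrightarrow> opV g k = opV h k"
  unfolding opV_def by (intro sum.cong) auto

lemma opV_0 [simp]: "opV g 0 = 0"
  by (simp add: opV_def)

lemma Rc_Suc: "1 \<le> b \<Longrightarrow> Rc k (Suc b) = Rc k b * (1 - p b / p k)"
  by (simp add: Rc_def)

text \<open>The product contains the factor with j = k, which is zero. Hence V is lower
  triangular.\<close>

lemma Rc_eq_0: "1 \<le> k \<Longrightarrow> k < b \<Longrightarrow> Rc k b = 0"
  using p_pos[of k] by (auto simp: Rc_def intro!: bexI[of _ k])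

lemma Vc_telescope: "1 \<le> b \<Longrightarrow> Vc k b = Rc k b - Rc k (Suc b)"
  by (simp add: Vc_def Rc_Suc algebra_simps)

lemma sum_Vc:
  assumes "1 \<le> b" "b \<le> k"
  shows "(\<Sum>c\<in>{b..k}. Vc k c) = Rc k b"
proof -
  have "(\<Sum>c\<in>{b..k}. Vc k c) = (\<Sum>c\<in>{b..k}. Rc k c - Rc k (Suc c))"
    using assms by (intro sum.cong refl Vc_telescope) auto
  also have "\<dots> = Rc k b - Rc k (Suc k)"
    using assms sum_Suc_diff[of b k "\<lambda>c. - Rc k c"] by simp
  finally show ?thesis using assms by (simp add: Rc_eq_0)
qed

text \<open>A full row of V telescopes to \<open>Rc k 1\<close>, an empty product divided by
  [k].\<close>

lemma opY_unit_seq_0: "opY (unit_seq 0) = opV (\<lambda>_. 1)"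
proof
  fix k show "opY (unit_seq 0) k = opV (\<lambda>_. 1) k"
    using sum_Vc[of 1 k] by (cases "k = 0") (auto simp: opY_def opV_def unit_seq_def Rc_def)
qed

text \<open>Exchanging the sums over j \<le> b \<le> k leaves the row tail \<open>Rc k j\<close>,
  and \<open>p j * Rc k j = p k * Vc k j\<close>.\<close>

lemma opX_opV: "opX (opV g) = opV (tX g)"
proof
  fix k
  have "opV (tX g) k = (\<Sum>b\<in>{1..k}. \<Sum>j\<in>{1..b}. Vc k b * (p j * g j))"
    by (simp add: opV_def tX_def sum_distrib_left)
  also have "\<dots> = (\<Sum>j\<in>{1..k}. \<Sum>b\<in>{j..k}. Vc k b * (p j * g j))"
  proof -
    let ?F = "\<lambda>b j. Vc k b * (p j * g j)"
    have "(\<Sum>b\<in>{1..k}. \<Sum>j\<in>{1..b}. ?F b j) = (\<Sum>b\<in>{1..k}. \<Sum>j\<in>{j\<in>{1..k}. j \<le> b}. ?F b j)"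
      by (intro sum.cong refl) auto
    also have "\<dots> = (\<Sum>j\<in>{1..k}. \<Sum>b\<in>{b\<in>{1..k}. j \<le> b}. ?F b j)"
      by (rule sum.swap_restrict) auto
    also have "\<dots> = (\<Sum>j\<in>{1..k}. \<Sum>b\<in>{j..k}. ?F b j)"
      by (intro sum.cong refl) auto
    finally show ?thesis .
  qed
  also have "\<dots> = (\<Sum>j\<in>{1..k}. p k * (Vc k j * g j))"
  proof (rule sum.cong[OF refl])
    fix j assume j: "j \<in> {1..k}"
    then have "p j > 0" "p k > 0" using p_pos by auto
    with j show "(\<Sum>b\<in>{j..k}. Vc k b * (p j * g j)) = p k * (Vc k j * g j)"
      unfolding sum_distrib_right[symmetric] by (simp add: sum_Vc) (simp add: Vc_def)
  qed
  finally show "opX (opV g) k = opV (tX g) k"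
    by (simp add: opX_def opV_def sum_distrib_left)
qed

text \<open>A recursion down each column, proved by induction over columns: passing from column b to
  b + 1 multiplies the entry in row m by (1 - p b / p m) p (b + 1) / p b.\<close>

lemma Vc_Suc:
  assumes "1 \<le> k" "1 \<le> b"
  shows "(q ^ b - q ^ Suc k) / (1 - q) * Vc (Suc k) b = qint q k * Vc k b"
  using assms(2)
proof (induction b rule: dec_induct)
  case base
  \<comment> \<open>The first column is explicit: \<open>Vc k 1 = q / q ^ k\<close>.\<close>
  then show ?case
    using assms(1) qint_pos[of k] qint_pos[of "Suc k"] q_pos q_less_1
    by (simp add: Vc_def Rc_def p_def field_simps) (simp add: qint_def field_simps)
next
  case (step b)
  have rec: "Vc m (Suc b) = (1 - p b / p m) * (p (Suc b) / p b) * Vc m b" if "1 \<le> m" for m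
    using p_pos[of m] p_pos[of b] step(1) that by (simp add: Vc_def Rc_Suc)
  have quot: "1 - p b / p m = (q ^ m - q ^ b) / ((1 - q) * qint q b * q ^ m)" if "1 \<le> m" for m
  proof -
    have "1 - p b / p m = (p m - p b) / p m"
      using p_pos[of m] that by (simp add: diff_divide_distrib)
    also have "\<dots> = (q ^ m - q ^ b) / ((1 - q) * qint q b * qint q m) / (q ^ m / qint q m)"
      using step(1) that by (subst p_diff) (simp_all add: p_def)
    also have "\<dots> = (q ^ m - q ^ b) / ((1 - q) * qint q b * q ^ m)"
      using qint_pos[of m] that by simp
    finally show ?thesis .
  qed
  \<comment> \<open>The factor q in q^(b+1) - q^(k+1) = q (q^b - q^k) balances the denominators
    q^(k+1) and q^k of the two ratios.\<close>
  have "(q ^ Suc b - q ^ Suc k) * (1 - p b / p (Suc k)) = (q ^ b - q ^ Suc k) * (1 - p b / p k)"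
    using assms(1) q_pos q_less_1 step(1) qint_pos[of b] by (simp add: quot field_simps)
  then have "(q ^ Suc b - q ^ Suc k) / (1 - q) * Vc (Suc k) (Suc b) =
      (1 - p b / p k) * (p (Suc b) / p b) * ((q ^ b - q ^ Suc k) / (1 - q) * Vc (Suc k) b)"
  proof -
    have "e / c * (r * s * v) = r' * s * (e' / c * v)" if "e * r = e' * r'" for e e' r r' s v c :: real
    proof -
      have "e / c * (r * s * v) = (e * r) * (s * v / c)" by simp
      also have "\<dots> = r' * s * (e' / c * v)" unfolding that by simp
      finally show ?thesis .
    qed
    moreover have "1 \<le> Suc k" by simp
    ultimately show ?thesis
      using \<open>_ = (q ^ b - q ^ Suc k) * (1 - p b / p k)\<close> by (simp only: rec)
  qed
  also have "\<dots> = qint q k * Vc k (Suc b)"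
    using assms(1) unfolding step.IH by (simp add: rec)
  finally show ?case .
qed

text \<open>Divided by [k], this is the entry of yV at (k, b). In the induction, adding
  \<open>Vc k b\<close> turns the coefficient into [k] / [b], and \<open>Vc_Suc\<close> then moves
  to row k + 1.\<close>

lemma sum_Vc_column:
  assumes "1 \<le> b" "1 \<le> k"
  shows "(\<Sum>j\<in>{1..<k}. Vc j b) = qint q k * (p b - p k) * Vc k b"
  using assms(2)
proof (induction k rule: dec_induct)
  case base
  \<comment> \<open>The sum is empty; on the right either p b = p 1 or the entry lies above the
    diagonal.\<close>
  then show ?case using assms(1) Rc_eq_0[of 1 b] by (cases "b = 1") (auto simp: Vc_def)
next
  case (step k)
  have *: "qint q m * (p b - p m) = (q ^ b - q ^ m) / ((1 - q) * qint q b)" if "1 \<le> m" for m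
    using p_diff[of b m] assms(1) that qint_pos[of m] by simp
  have "(\<Sum>j\<in>{1..<Suc k}. Vc j b) = (qint q k * (p b - p k) + 1) * Vc k b"
    using step by (simp add: algebra_simps)
  also have "qint q k * (p b - p k) + 1 = qint q k / qint q b"
  proof -
    have "qint q k - qint q b = (q ^ b - q ^ k) / (1 - q)"
      by (simp add: qint_def diff_divide_distrib[symmetric])
    then have "qint q k * (p b - p k) = (qint q k - qint q b) / qint q b"
      unfolding *[OF step(1)] by (metis divide_divide_eq_left)
    then show ?thesis
      using qint_pos[of b] assms(1) by (simp add: field_simps)
  qed
  also have "\<dots> * Vc k b = qint q (Suc k) * (p b - p (Suc k)) * Vc (Suc k) b"
  proof -
    have "qint q k / qint q b * Vc k b = qint q k * Vc k b / qint q b"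
      by simp
    also have "\<dots> = (q ^ b - q ^ Suc k) / (1 - q) * Vc (Suc k) b / qint q b"
      using step(1) assms(1) by (simp only: Vc_Suc One_nat_def)
    also have "\<dots> = (q ^ b - q ^ Suc k) / ((1 - q) * qint q b) * Vc (Suc k) b"
      by (simp only: divide_divide_eq_left times_divide_eq_left)
    finally show ?thesis by (subst *) simp_all
  qed
  finally show ?case .
qed

text \<open>The columns of V are eigenvectors: y contributes (p b - p k) \<open>Vc k b\<close> and x
  contributes p k \<open>Vc k b\<close>, leaving the eigenvalue p b.\<close>

lemma opZ_opV: "opZ (opV g) = opV (\<lambda>k. p k * g k)"
proof
  fix k
  show "opZ (opV g) k = opV (\<lambda>k. p k * g k) k"
  proof (cases "k = 0")
    case True
    then show ?thesis by (simp add: opZ_def opX_def opY_def)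
  next
    case False
    have vanish: "Vc j b = 0" if "1 \<le> j" "j < b" for j b
      using that by (simp add: Vc_def Rc_eq_0)
    have "(\<Sum>j<k. opV g j) = (\<Sum>j\<in>{1..<k}. opV g j)"
      by (rule sum.mono_neutral_right) (auto simp: Suc_le_eq)
    \<comment> \<open>Rows are padded by the zeros above the diagonal so that the summation ranges
      become independent.\<close>
    also have "\<dots> = (\<Sum>j\<in>{1..<k}. \<Sum>b\<in>{1..k}. Vc j b * g b)"
      unfolding opV_def by (intro sum.cong refl sum.mono_neutral_left) (auto simp: vanish)
    also have "\<dots> = (\<Sum>b\<in>{1..k}. (\<Sum>j\<in>{1..<k}. Vc j b) * g b)"
      by (subst sum.swap) (simp add: sum_distrib_right)
    also have "\<dots> = (\<Sum>b\<in>{1..k}. qint q k * (p b - p k) * Vc k b * g b)"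
      using False by (intro sum.cong refl) (subst sum_Vc_column, auto)
    finally have "opY (opV g) k = (\<Sum>b\<in>{1..k}. (p b - p k) * Vc k b * g b)"
      using qint_pos[of k] False by (simp add: opY_def sum_divide_distrib mult.assoc)
    then show ?thesis
      by (simp add: opZ_def opX_def opV_def sum_distrib_left sum.distrib[symmetric] algebra_simps)
  qed
qed

lemma opY_opV: "opY (opV g) = opV (tY g)"
proof -
  have "opY (opV g) = (\<lambda>k. opZ (opV g) k - opX (opV g) k)"
    by (simp add: opZ_def fun_eq_iff)
  then show ?thesis
    by (simp add: opZ_opV opX_opV linop_diff[OF linop_opV, symmetric] tY_def[abs_def])
qed

lemma opZ_power_opV: "(opZ ^^ m) (opV g) = opV (\<lambda>k. p k ^ m * g k)"
  by (induction m) (simp_all add: opZ_opV mult.assoc)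

fun tletter_op :: "letter \<Rightarrow> (nat \<Rightarrow> real) \<Rightarrow> nat \<Rightarrow> real" where
  "tletter_op X = tX"
| "tletter_op Y = tY"

definition tword_op :: "letter list \<Rightarrow> (nat \<Rightarrow> real) \<Rightarrow> nat \<Rightarrow> real" where
  "tword_op w = foldr tletter_op w"

lemma tword_op_simps [simp]:
  "tword_op [] g = g"
  "tword_op (a # w) g = tletter_op a (tword_op w g)"
  by (simp_all add: tword_op_def)

lemma letter_op_opV: "letter_op a (opV g) = opV (tletter_op a g)"
  by (cases a) (simp_all add: opX_opV opY_opV)

lemma word_op_opV: "word_op w (opV g) = opV (tword_op w g)"
  by (induction w) (simp_all add: letter_op_opV)

section \<open>The derivation as a commutator with phi\<close>

definition phi :: "nat \<Rightarrow> nat \<Rightarrow> real" where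
  "phi n k = - (\<Sum>j\<in>{1..k}. p j ^ n)"

definition tdelta :: "nat \<Rightarrow> (nat \<Rightarrow> real) \<Rightarrow> nat \<Rightarrow> real" where
  "tdelta n g = tX (\<lambda>j. p j ^ (n - 1) * tY g j)"

lemma deltaX_opV: "deltaX n (opV g) = opV (tdelta n g)"
  by (simp add: deltaX_def tdelta_def opY_opV opZ_power_opV opX_opV)

text \<open>Summation by parts: phi changes by - p^n at each index, and
  \<open>p k * g k - tX g k\<close> is minus the previous partial sum.\<close>

lemma tdelta_eq:
  assumes "0 < n"
  shows "tdelta n g k = phi n k * tX g k - tX (\<lambda>j. phi n j * g j) k"
proof (induction k)
  case 0
  then show ?case by (simp add: tdelta_def tX_def)
next
  case (Suc k)
  have pn: "p j * p j ^ (n - 1) = p j ^ n" for j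
    using assms by (simp add: power_eq_if)
  have tX_Suc: "tX h (Suc k) = tX h k + p (Suc k) * h (Suc k)" for h
    by (simp add: tX_def)
  have "tdelta n g (Suc k) = tdelta n g k - p (Suc k) ^ n * tX g k"
    unfolding tdelta_def tX_Suc by (simp add: tY_def tX_Suc pn[symmetric] algebra_simps)
  also have "\<dots> = phi n (Suc k) * tX g (Suc k) - tX (\<lambda>j. phi n j * g j) (Suc k)"
    unfolding Suc tX_Suc by (simp add: phi_def algebra_simps)
  finally show ?case .
qed

text \<open>For y, multiplication by p commutes with phi, so only the part - tX contributes; this
  accounts for the opposite sign.\<close>

lemma tletter_commutator:
  assumes "0 < n"
  shows "(if a = X then tdelta n g k else - tdelta n g k) + tletter_op a (\<lambda>j. phi n j * g j) k =
    phi n k * tletter_op a g k"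
  by (cases a) (simp_all add: tdelta_eq[OF assms] tY_def algebra_simps)

lemma deltaX_unit_seq_0:
  assumes "0 < n"
  shows "deltaX n (unit_seq 0) = (\<lambda>k. - opV (phi n) k)"
proof -
  have "deltaX n (unit_seq 0) = opV (\<lambda>k. tX (\<lambda>j. p j ^ (n - 1)) k)"
    by (simp add: deltaX_def opY_unit_seq_0 opZ_power_opV opX_opV)
  also have "tX (\<lambda>j. p j ^ (n - 1)) = (\<lambda>k. (-1) * phi n k)"
    using assms by (simp add: tX_def phi_def fun_eq_iff power_eq_if)
  finally show ?thesis
    unfolding linop_scale[OF linop_opV] by simp
qed

text \<open>Differentiating the final y produces phi times the constant 1. Each letter added on the
  left moves phi past itself, so the Leibniz sum collapses to one multiplication by phi.\<close>

lemma poly_op_dword: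
  assumes "0 < n"
  shows "poly_op (dword n (u @ [Y])) (unit_seq 0) = opV (\<lambda>k. phi n k * tword_op u (\<lambda>_. 1) k)"
proof (induction u)
  case Nil
  show ?case
    unfolding append_Nil poly_op_dword_Cons
    by (simp add: poly_op_dgen linop_zero[OF linop_opY] deltaX_unit_seq_0[OF assms])
next
  case (Cons a u)
  let ?h = "tword_op u (\<lambda>_. 1)"
  have w: "word_op (u @ [Y]) (unit_seq 0) = opV ?h"
    by (simp add: opY_unit_seq_0 word_op_opV)
  have d: "poly_op (dgen n a) (opV ?h) = opV (\<lambda>k. if a = X then tdelta n ?h k else - tdelta n ?h k)"
    using linop_scale[OF linop_opV, of "-1"]
    by (cases a) (simp_all add: poly_op_dgen deltaX_opV)
  show ?case
    unfolding append_Cons poly_op_dword_Cons w d Cons letter_op_opV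
      linop_add[OF linop_opV, symmetric] tletter_commutator[OF assms] by simp
qed

lemma linop_deltaX: "linop (deltaX n)"
  unfolding deltaX_def[abs_def]
  by (intro linop_compose[OF linop_opX] linop_compose[OF linop_power[OF linop_opZ]] linop_opY)

section \<open>The matrix H and its diagonal form\<close>

text \<open>The off-diagonal entries are forced by \<open>H x - x H = deltaX\<close>, because \<open>x\<close> is diagonal with distinct
  entries.\<close>

definition opH :: "nat \<Rightarrow> (nat \<Rightarrow> real) \<Rightarrow> nat \<Rightarrow> real" where
  "opH n f a = phi n a * f a + (\<Sum>b\<in>{1..<a}. deltaX n (unit_seq b) a / (p b - p a) * f b)"

lemma linop_opH: "linop (opH n)"
  unfolding opH_def[abs_def] by (intro linop_add_op linop_mult linop_kernel)

text \<open>The inner y sums strictly below its index and the outer operators are lower triangular,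
  so entry a depends only on f below a; \<open>f 0 = 0\<close> removes column 0.\<close>

lemma deltaX_expand:
  assumes "f 0 = 0"
  shows "deltaX n f a = (\<Sum>b\<in>{1..<a}. deltaX n (unit_seq b) a * f b)"
proof -
  let ?f = "\<lambda>k. \<Sum>b\<in>{1..<a}. f b * unit_seq b k"
  have "f j = ?f j" if "j < a" for j
    using that assms by (cases "j = 0") (auto simp: sum_unit_seq)
  then have "opY f j = opY ?f j" if "j \<le> a" for j
    using that unfolding opY_def by (intro arg_cong2[where f = "(/)"] sum.cong) auto
  then have "(opZ ^^ (n - 1)) (opY f) a = (opZ ^^ (n - 1)) (opY ?f) a"
    by (rule lowerD[OF lower_power[OF lower_opZ]])
  then have "deltaX n f a = deltaX n ?f a"
    by (simp only: deltaX_def opX_def)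
  then show ?thesis
    by (simp add: linop_sum[OF linop_deltaX] mult.commute)
qed

text \<open>Writing p b = p a + (p b - p a) in each off-diagonal term cancels the denominator and
  releases the \<open>deltaX\<close> entry.\<close>

lemma opH_opX:
  assumes "f 0 = 0"
  shows "opH n (opX f) a = p a * opH n f a + deltaX n f a"
proof -
  have "(\<Sum>b\<in>{1..<a}. deltaX n (unit_seq b) a / (p b - p a) * (p b * f b)) =
      (\<Sum>b\<in>{1..<a}. p a * (deltaX n (unit_seq b) a / (p b - p a) * f b) + deltaX n (unit_seq b) a * f b)"
  proof (rule sum.cong[OF refl])
    fix b assume "b \<in> {1..<a}"
    then have "p b - p a \<noteq> 0" using p_less[of b a] by auto
    then show "deltaX n (unit_seq b) a / (p b - p a) * (p b * f b) =
        p a * (deltaX n (unit_seq b) a / (p b - p a) * f b) + deltaX n (unit_seq b) a * f b"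
      by (simp add: field_simps)
  qed
  then show ?thesis
    unfolding opH_def opX_def deltaX_expand[of f, OF assms]
    by (simp add: sum.distrib sum_distrib_left algebra_simps)
qed

text \<open>The difference \<open>W = H V - V \<phi>\<close> satisfies \<open>W tX = x W\<close> and has zero diagonal. Evaluated on unit
  sequences, this forces row \<open>a\<close> of \<open>W\<close> to vanish on the step functions at \<open>b = a, a - 1, ..., 1\<close>.\<close>

lemma opH_opV:
  assumes "0 < n"
  shows "opH n (opV g) = opV (\<lambda>k. phi n k * g k)"
proof
  fix a
  define W where "W = (\<lambda>g k. opH n (opV g) k - opV (\<lambda>k. phi n k * g k) k)"
  have lin: "linop W"
    using linop_compose[OF linop_opH linop_opV, of n] linop_compose[OF linop_opV linop_mult, of "phi n"]
    unfolding W_def by (simp add: linop_def algebra_simps)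
  \<comment> \<open>Both HV and V phi satisfy T tX = x T + V \<open>tdelta\<close>, so the
    inhomogeneous term cancels in their difference.\<close>
  have W_tX: "W (tX h) a = p a * W h a" for h
  proof -
    have "opH n (opV (tX h)) a = p a * opH n (opV h) a + opV (tdelta n h) a"
      using opH_opX[of "opV h" n a] by (simp add: opX_opV deltaX_opV)
    moreover have "opV (\<lambda>k. phi n k * tX h k) a = opV (tdelta n h) a + opV (tX (\<lambda>k. phi n k * h k)) a"
      using linop_add[OF linop_opV, of "tdelta n h" "tX (\<lambda>k. phi n k * h k)"]
      by (simp add: tdelta_eq[OF assms])
    moreover have "opV (tX (\<lambda>k. phi n k * h k)) a = p a * opV (\<lambda>k. phi n k * h k) a"
      by (simp add: opX_opV[symmetric] opX_def)
    ultimately show ?thesis by (simp add: W_def algebra_simps)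
  qed
  define step where "step = (\<lambda>b k::nat. if b \<le> k then 1 else (0::real))"
  have unit: "unit_seq b = (\<lambda>k. step b k - step (Suc b) k)" for b
    by (auto simp: unit_seq_def step_def fun_eq_iff)
  \<comment> \<open>Below a the sequence vanishes, so only diagonal entries act, and both products
    give phi a \<open>Vc a a\<close>.\<close>
  have W_step_a: "W (step a) a = 0"
  proof -
    have "opV h b = (if b = a then Vc a a * h a else 0)"
      if "b \<le> a" "\<And>j. j < a \<Longrightarrow> h j = 0" "a \<ge> 1" for h b
    proof (cases "b = a")
      case True
      then have "opV h a = (\<Sum>j\<in>{a}. Vc a j * h j)"
        unfolding opV_def using that by (intro sum.mono_neutral_right) auto
      with True show ?thesis by simp
    qed (use that in \<open>auto simp: opV_def\<close>)
    then show ?thesis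
      by (cases "a = 0") (auto simp: W_def opH_def step_def phi_def)
  qed
  have W_step: "W (step b) a = 0" if "1 \<le> b" "b \<le> a" for b
    using that(2,1)
  proof (induction rule: inc_induct)
    case base
    then show ?case by (simp add: W_step_a)
  next
    case (step b)
    \<comment> \<open>Since W already vanishes on the next step function, the unit sequence and the
      step at b have the same image, and p b W = p a W with p b > p a forces zero.\<close>
    have "tX (unit_seq b) = (\<lambda>k. p b * step b k)"
      using step.prems
      by (auto simp: tX_def unit_seq_def step_def fun_eq_iff if_distrib sum.delta cong: if_cong)
    then have "p b * W (step b) a = p a * W (unit_seq b) a"
      using W_tX[of "unit_seq b"] by (simp add: linop_scale[OF lin])
    also have "W (unit_seq b) a = W (step b) a"
      using step by (simp add: unit linop_diff[OF lin])
    finally show ?case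
      using p_less[of b a] step by simp
  qed
  have "W (step (Suc a)) a = 0"
  proof -
    have "opV (\<lambda>k. c k * step (Suc a) k) b = 0" if "b \<le> a" for b c
      using that by (auto simp: opV_def step_def)
    from this[of _ "\<lambda>_. 1"] this[of _ "phi n"] show ?thesis
      by (simp add: W_def opH_def)
  qed
  then have W_unit: "W (unit_seq b) a = 0" if "1 \<le> b" "b \<le> a" for b
    using that W_step[of b] W_step[of "Suc b"] by (cases "b = a") (auto simp: unit linop_diff[OF lin])
  \<comment> \<open>Row a of W sees only the entries of g at 1, ..., a, so g may be replaced by a
    finite combination of unit sequences.\<close>
  have cong: "opV (\<lambda>k. c k * g k) b = opV (\<lambda>k. c k * (\<Sum>i\<in>{1..a}. g i * unit_seq i k)) b" if "b \<le> a" for b c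
    using that by (intro opV_cong) (auto simp: sum_unit_seq)
  have "W g a = W (\<lambda>k. \<Sum>i\<in>{1..a}. g i * unit_seq i k) a"
    using cong[of _ "\<lambda>_. 1"] cong[of a "phi n"] by (simp add: W_def opH_def)
  also have "\<dots> = 0"
    by (simp add: linop_sum[OF lin] W_unit)
  finally show "opH n (opV g) a = opV (\<lambda>k. phi n k * g k) a"
    by (simp add: W_def)
qed

section \<open>Growth and decay estimates\<close>

text \<open>Leading constant 1 is enough: a letter's output is at most a partial sum of absolute
  values, which raises only the degree.\<close>

definition poly_bounded :: "nat \<Rightarrow> (nat \<Rightarrow> real) \<Rightarrow> bool" where
  "poly_bounded m f \<longleftrightarrow> (\<forall>k. \<bar>f k\<bar> \<le> (real k + 1) ^ m)"

text \<open>The rate \<open>sqrt q\<close> instead of \<open>q\<close> absorbs polynomial factors.\<close>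

definition geometric :: "(nat \<Rightarrow> real) \<Rightarrow> bool" where
  "geometric f \<longleftrightarrow> (\<exists>C\<ge>0. \<forall>k. \<bar>f k\<bar> \<le> C * sqrt q ^ k)"

lemma abs_opX_le: "\<bar>opX f k\<bar> \<le> \<bar>f k\<bar>"
  using p_nonneg[of k] p_le_1[of k] by (simp add: opX_def abs_mult mult_left_le_one_le)

lemma abs_opY_le: "\<bar>opY f k\<bar> \<le> (\<Sum>j<k. \<bar>f j\<bar>)"
proof (cases "k = 0")
  case False
  have "\<bar>opY f k\<bar> = \<bar>\<Sum>j<k. f j\<bar> / qint q k"
    using qint_nonneg[of k] by (simp add: opY_def)
  also have "\<dots> \<le> \<bar>\<Sum>j<k. f j\<bar>"
    using qint_ge_1[of k] False by (simp add: divide_le_eq mult_le_cancel_left1)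
  also have "\<dots> \<le> (\<Sum>j<k. \<bar>f j\<bar>)" by (rule sum_abs)
  finally show ?thesis .
qed (simp add: opY_def)

lemma poly_bounded_sum:
  assumes "poly_bounded m f"
  shows "(\<Sum>j\<le>k. \<bar>f j\<bar>) \<le> (real k + 1) ^ Suc m"
proof -
  have "(\<Sum>j\<le>k. \<bar>f j\<bar>) \<le> (\<Sum>j\<le>k. (real k + 1) ^ m)"
  proof (rule sum_mono)
    fix j assume "j \<in> {..k}"
    then have "(real j + 1) ^ m \<le> (real k + 1) ^ m" by (intro power_mono) auto
    then show "\<bar>f j\<bar> \<le> (real k + 1) ^ m"
      using assms unfolding poly_bounded_def by (meson order_trans)
  qed
  then show ?thesis by (simp add: algebra_simps)
qed

lemma poly_bounded_if_le:
  "poly_bounded m f \<Longrightarrow> (\<And>k. \<bar>g k\<bar> \<le> (\<Sum>j\<le>k. \<bar>f j\<bar>)) \<Longrightarrow> poly_bounded (Suc m) g"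
  using poly_bounded_sum unfolding poly_bounded_def by (meson order_trans)

lemma poly_bounded_opZ: "poly_bounded m f \<Longrightarrow> poly_bounded (Suc m) (opZ f)"
proof (erule poly_bounded_if_le)
  fix k
  show "\<bar>opZ f k\<bar> \<le> (\<Sum>j\<le>k. \<bar>f j\<bar>)"
    using abs_opX_le[of f k] abs_opY_le[of f k] by (simp add: opZ_def lessThan_Suc_atMost[symmetric])
qed

lemma poly_bounded_opY: "poly_bounded m f \<Longrightarrow> poly_bounded (Suc m) (opY f)"
proof (erule poly_bounded_if_le)
  fix k
  show "\<bar>opY f k\<bar> \<le> (\<Sum>j\<le>k. \<bar>f j\<bar>)"
    using abs_opY_le[of f k] by (simp add: lessThan_Suc_atMost[symmetric])
qed

lemma poly_bounded_letter_op: "poly_bounded m f \<Longrightarrow> poly_bounded (Suc m) (letter_op a f)"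
proof (cases a)
  case X
  have "\<bar>opX f k\<bar> \<le> (\<Sum>j\<le>k. \<bar>f j\<bar>)" for k
    using abs_opX_le[of f k] member_le_sum[of k "{..k}" "\<lambda>j. \<bar>f j\<bar>"] by simp
  then show "poly_bounded m f \<Longrightarrow> ?thesis" using X poly_bounded_if_le by simp
qed (simp add: poly_bounded_opY)

lemma poly_bounded_word_op: "poly_bounded m f \<Longrightarrow> poly_bounded (length w + m) (word_op w f)"
  by (induction w) (auto intro: poly_bounded_letter_op)

lemma poly_bounded_opZ_power: "poly_bounded m f \<Longrightarrow> poly_bounded (i + m) ((opZ ^^ i) f)"
  by (induction i) (auto intro: poly_bounded_opZ)

lemma poly_bounded_unit_seq: "poly_bounded 0 (unit_seq b)"
  by (simp add: poly_bounded_def unit_seq_def)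

lemma sqrt_q: "0 < sqrt q" "sqrt q < 1"
  using q_pos q_less_1 by simp_all

lemma q_power_eq: "q ^ k = sqrt q ^ k * sqrt q ^ k"
  using q_pos by (simp add: power_mult_distrib[symmetric])

text \<open>Of the two factors \<open>sqrt q ^ k\<close> in \<open>q ^ k\<close>, one keeps the
  polynomial below a constant C and the other remains as the rate.\<close>

lemma geometric_opX:
  assumes "poly_bounded m f"
  shows "geometric (opX f)"
proof -
  have "Bseq (\<lambda>k. (real k + 1) ^ m * sqrt q ^ k)"
    using tendsto_poly_times_geometric[OF sqrt_q] by (intro convergent_imp_Bseq convergentI)
  then obtain C where C: "C > 0" "\<And>k. (real k + 1) ^ m * sqrt q ^ k \<le> C"
    unfolding Bseq_def by (metis abs_le_D1 real_norm_def)
  have "\<bar>opX f k\<bar> \<le> C * sqrt q ^ k" for k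
  proof -
    have "\<bar>opX f k\<bar> \<le> q ^ k * (real k + 1) ^ m"
      using assms p_le[of k] p_nonneg[of k] q_pos
      by (auto simp: opX_def abs_mult poly_bounded_def intro!: mult_mono)
    also have "\<dots> = (real k + 1) ^ m * sqrt q ^ k * sqrt q ^ k"
      by (simp add: q_power_eq)
    also have "\<dots> \<le> C * sqrt q ^ k"
      using C(2)[of k] sqrt_q by (intro mult_right_mono) auto
    finally show ?thesis .
  qed
  with C(1) show ?thesis unfolding geometric_def by (intro exI[of _ C]) auto
qed

lemma geometric_add:
  assumes "geometric f" "geometric g"
  shows "geometric (\<lambda>k. f k + g k)"
proof -
  obtain C D where "C \<ge> 0" "D \<ge> 0" "\<And>k. \<bar>f k\<bar> \<le> C * sqrt q ^ k" "\<And>k. \<bar>g k\<bar> \<le> D * sqrt q ^ k"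
    using assms unfolding geometric_def by blast
  then show ?thesis
    unfolding geometric_def
    by (intro exI[of _ "C + D"]) (auto simp: distrib_right intro: order_trans[OF abs_triangle_ineq add_mono])
qed

lemma geometric_tendsto_0:
  assumes "geometric f" shows "f \<longlonglongrightarrow> 0"
proof -
  obtain C where "\<And>k. \<bar>f k\<bar> \<le> C * sqrt q ^ k"
    using assms unfolding geometric_def by blast
  moreover have "(\<lambda>k. C * sqrt q ^ k) \<longlonglongrightarrow> 0"
    using sqrt_q by (intro tendsto_mult_right_zero LIMSEQ_power_zero) simp
  ultimately show ?thesis
    by (intro Lim_null_comparison[of f "\<lambda>k. C * sqrt q ^ k"]) auto
qed

lemma geometric_summable:
  assumes "geometric f" shows "summable f"
proof -
  obtain C where "\<And>k. \<bar>f k\<bar> \<le> C * sqrt q ^ k"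
    using assms unfolding geometric_def by blast
  then show ?thesis
    using sqrt_q by (intro summable_comparison_test[of f "\<lambda>k. C * sqrt q ^ k"] summable_mult summable_geometric) auto
qed

lemma geometric_tail:
  assumes "geometric f"
  shows "geometric (\<lambda>k. suminf f - (\<Sum>j<k. f j))"
proof -
  obtain C where C: "C \<ge> 0" "\<And>k. \<bar>f k\<bar> \<le> C * sqrt q ^ k"
    using assms unfolding geometric_def by blast
  have "\<bar>suminf f - (\<Sum>j<k. f j)\<bar> \<le> C / (1 - sqrt q) * sqrt q ^ k" for k
  proof -
    have sums: "(\<lambda>j. C * sqrt q ^ k * sqrt q ^ j) sums (C * sqrt q ^ k * (1 / (1 - sqrt q)))"
      using sqrt_q by (intro sums_mult geometric_sums) simp
    have "suminf f - (\<Sum>j<k. f j) = (\<Sum>j. f (j + k))"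
      using suminf_minus_initial_segment[OF geometric_summable[OF assms], of k] by simp
    also have "\<bar>\<dots>\<bar> \<le> (\<Sum>j. C * sqrt q ^ k * sqrt q ^ j)"
    proof -
      have "norm (f (j + k)) \<le> C * sqrt q ^ k * sqrt q ^ j" for j
        using C(2)[of "j + k"] by (simp add: power_add mult_ac)
      then show ?thesis
        using norm_suminf_le[of "\<lambda>j. f (j + k)", OF _ sums_summable[OF sums]] by simp
    qed
    also have "\<dots> = C / (1 - sqrt q) * sqrt q ^ k"
      using sums_unique[OF sums] by simp
    finally show ?thesis .
  qed
  then show ?thesis
    using C(1) sqrt_q unfolding geometric_def by (intro exI[of _ "C / (1 - sqrt q)"]) auto
qed

lemma geometric_divide_qint:
  assumes "geometric f" shows "geometric (\<lambda>k. f k / qint q k)"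
proof -
  have "\<bar>f k / qint q k\<bar> \<le> \<bar>f k\<bar>" for k
    using qint_ge_1[of k] by (cases "k = 0") (auto simp: divide_le_eq mult_le_cancel_left1)
  then show ?thesis
    using assms unfolding geometric_def by (meson order_trans)
qed

lemma geometric_uminus: "geometric f \<Longrightarrow> geometric (\<lambda>k. - f k)"
  by (simp add: geometric_def)

lemma poly_bounded_deltaX:
  assumes "0 < n" "poly_bounded m f"
  obtains g where "deltaX n f = opX g" "poly_bounded (n + m) g"
  using poly_bounded_opZ_power[OF poly_bounded_opY[OF assms(2)], of "n - 1"] assms(1) that
  unfolding deltaX_def by simp

lemma abs_phi_le: "\<bar>phi n a\<bar> \<le> real a"
proof -
  have "(\<Sum>j\<in>{1..a}. p j ^ n) \<le> (\<Sum>j\<in>{1..a}. 1)"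
    using p_nonneg p_le_1 by (intro sum_mono power_le_one) auto
  moreover have "0 \<le> (\<Sum>j\<in>{1..a}. p j ^ n)"
    using p_nonneg by (intro sum_nonneg) auto
  ultimately show ?thesis by (simp add: phi_def)
qed

text \<open>The outer x gives a factor p a, and p a \<le> q^(a-b) p b together with q^(a-b) \<le> q
  keeps p a / (p b - p a) below q^(a-b) / (1 - q). The rest has polynomial growth.\<close>

lemma opH_coeff_bound:
  assumes "0 < n" "1 \<le> b" "b < a"
  shows "\<bar>deltaX n (unit_seq b) a / (p b - p a)\<bar> \<le> q ^ (a - b) * ((real a + 1) ^ n / (1 - q))"
proof -
  obtain g where g: "deltaX n (unit_seq b) = opX g" "poly_bounded n g"
    using poly_bounded_deltaX[OF assms(1) poly_bounded_unit_seq] by auto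
  have pos: "p b - p a > 0" using p_less assms by simp
  have "qint q b \<le> qint q a"
    using assms q_pos q_less_1 by (simp add: qint_def divide_right_mono power_decreasing)
  then have "p a \<le> q ^ a / qint q b"
    using qint_pos[of b] qint_pos[of a] assms q_pos unfolding p_def by (intro divide_left_mono) auto
  also have "\<dots> = q ^ (a - b) * p b"
    using assms by (simp add: p_def power_add[symmetric])
  finally have "p a \<le> q ^ (a - b) * p b" .
  moreover have "q ^ (a - b) \<le> q"
    using power_decreasing[of 1 "a - b" q] assms q_pos q_less_1 by simp
  then have "q ^ (a - b) * p a \<le> q * p a"
    using p_nonneg by (rule mult_right_mono)
  ultimately have "p a * (1 - q) \<le> q ^ (a - b) * (p b - p a)"
    by (simp add: algebra_simps)
  then have *: "p a / (p b - p a) \<le> q ^ (a - b) / (1 - q)"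
    using pos q_less_1 by (simp add: field_simps)
  have "\<bar>deltaX n (unit_seq b) a / (p b - p a)\<bar> = p a / (p b - p a) * \<bar>g a\<bar>"
    using pos p_nonneg[of a] by (simp add: g(1) opX_def abs_mult)
  also have "\<dots> \<le> q ^ (a - b) / (1 - q) * (real a + 1) ^ n"
    using * g(2) q_pos q_less_1 by (intro mult_mono) (auto simp: poly_bounded_def)
  finally show ?thesis by simp
qed

lemma opH_tendsto_0:
  assumes "0 < n" "geometric f"
  shows "opH n f \<longlonglongrightarrow> 0"
proof -
  obtain C where C: "C \<ge> 0" "\<And>k. \<bar>f k\<bar> \<le> C * sqrt q ^ k"
    using assms unfolding geometric_def by blast
  \<comment> \<open>The summand 1 pays for the diagonal, 1 / (1 - q) for each of the fewer than a
    entries left of it.\<close>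
  define D where "D = C * (1 + 1 / (1 - q))"
  have "\<bar>opH n f a\<bar> \<le> D * ((real a + 1) ^ Suc n * sqrt q ^ a)" for a
  proof -
    let ?M = "C * sqrt q ^ a * (real a + 1) ^ n"
    have M: "?M \<ge> 0" using C(1) sqrt_q by simp
    have diag: "\<bar>phi n a * f a\<bar> \<le> real a * ?M"
    proof -
      have "C * sqrt q ^ a * 1 \<le> ?M"
        using C(1) sqrt_q by (intro mult_left_mono) auto
      then have "\<bar>f a\<bar> \<le> ?M" using C(2)[of a] by simp
      then show ?thesis
        using abs_phi_le[of n a] by (auto simp: abs_mult intro!: mult_mono)
    qed
    have off: "\<bar>deltaX n (unit_seq b) a / (p b - p a) * f b\<bar> \<le> ?M / (1 - q)" if b: "b \<in> {1..<a}" for b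
    proof -
      \<comment> \<open>As q^(a-b) is \<open>sqrt q ^ (2 * (a - b))\<close>, the total exponent is
        at least a.\<close>
      have "sqrt q ^ (2 * (a - b) + b) \<le> sqrt q ^ a"
        using sqrt_q b by (intro power_decreasing) auto
      then have s: "q ^ (a - b) * sqrt q ^ b \<le> sqrt q ^ a"
        using q_pos by (simp add: power_add power_mult)
      have "\<bar>deltaX n (unit_seq b) a / (p b - p a) * f b\<bar> \<le>
          q ^ (a - b) * ((real a + 1) ^ n / (1 - q)) * (C * sqrt q ^ b)"
        unfolding abs_mult using b C(2)[of b] opH_coeff_bound[OF assms(1), of b a] q_pos q_less_1
        by (intro mult_mono) auto
      also have "\<dots> = (q ^ (a - b) * sqrt q ^ b) * (C * ((real a + 1) ^ n / (1 - q)))"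
        by simp
      also have "\<dots> \<le> sqrt q ^ a * (C * ((real a + 1) ^ n / (1 - q)))"
        using s C(1) q_less_1 by (intro mult_right_mono) auto
      finally show ?thesis by (simp add: mult_ac)
    qed
    have "\<bar>opH n f a\<bar> \<le> \<bar>phi n a * f a\<bar> + (\<Sum>b\<in>{1..<a}. \<bar>deltaX n (unit_seq b) a / (p b - p a) * f b\<bar>)"
      unfolding opH_def by (intro order_trans[OF abs_triangle_ineq] add_left_mono sum_abs)
    also have "\<dots> \<le> real a * ?M + (\<Sum>b\<in>{1..<a}. ?M / (1 - q))"
      using diag off by (intro add_mono sum_mono)
    also have "\<dots> = real a * ?M + real (a - 1) * (?M / (1 - q))"
      by simp
    also have "\<dots> \<le> (real a + 1) * ?M + (real a + 1) * (?M / (1 - q))"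
      using M q_less_1 by (intro add_mono mult_right_mono) auto
    also have "\<dots> = D * ((real a + 1) ^ Suc n * sqrt q ^ a)"
      by (simp add: D_def add_divide_distrib algebra_simps)
    finally show ?thesis .
  qed
  moreover have "(\<lambda>a. D * ((real a + 1) ^ Suc n * sqrt q ^ a)) \<longlonglongrightarrow> 0"
    by (intro tendsto_mult_right_zero tendsto_poly_times_geometric sqrt_q)
  ultimately show ?thesis
    by (intro Lim_null_comparison[of "opH n f" "\<lambda>a. D * ((real a + 1) ^ Suc n * sqrt q ^ a)"]) auto
qed

section \<open>Vanishing of the limit\<close>

lemma sum_opH_tendsto_0:
  assumes n: "0 < n" and f: "f = opV g" "geometric f"
  shows "(\<lambda>N. \<Sum>k\<le>N. opH n f k) \<longlonglongrightarrow> 0"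
proof -
  \<comment> \<open>Entries of y f approach the full sum of f divided by [k], which need not decay.
    Splitting off this multiple of V 1 leaves h, built from x f and the tails of the series.\<close>
  define h where "h = (\<lambda>k. p k * f k + - ((suminf f - (\<Sum>j<k. f j)) / qint q k))"
  have "geometric (\<lambda>k. p k * f k)"
    using f(2) abs_opX_le[of f] unfolding geometric_def opX_def by (meson order_trans)
  then have h: "geometric h"
    unfolding h_def using f(2)
    by (intro geometric_add geometric_uminus geometric_divide_qint geometric_tail)
  have r: "opY (unit_seq 0) k = 1 / qint q k" for k
    by (cases "k = 0") (auto simp: opY_def unit_seq_def)
  have "opZ f = (\<lambda>k. suminf f * opV (\<lambda>_. 1) k + h k)"
    by (simp add: fun_eq_iff opZ_def opX_def h_def opY_unit_seq_0[symmetric] r diff_divide_distrib)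
      (simp add: opY_def)
  then have "opH n (opZ f) = (\<lambda>a. suminf f * opH n (opV (\<lambda>_. 1)) a + opH n h a)"
    by (simp add: linop_add[OF linop_opH] linop_scale[OF linop_opH])
  \<comment> \<open>On the split-off part H acts explicitly: V phi is minus \<open>deltaX\<close> of
    the unit sequence, which decays because its outermost letter is x.\<close>
  also have "opH n (opV (\<lambda>_. 1)) = (\<lambda>k. - deltaX n (unit_seq 0) k)"
    by (simp add: opH_opV[OF n] deltaX_unit_seq_0[OF n])
  finally have *: "opH n (opZ f) = (\<lambda>a. suminf f * - deltaX n (unit_seq 0) a + opH n h a)" .
  have "geometric (deltaX n (unit_seq 0))"
    using poly_bounded_deltaX[OF n poly_bounded_unit_seq] geometric_opX by metis
  then have "opH n (opZ f) \<longlonglongrightarrow> suminf f * - 0 + 0"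
    unfolding * by (intro tendsto_intros geometric_tendsto_0 opH_tendsto_0 n h)
  then have limZ: "opH n (opZ f) \<longlonglongrightarrow> 0" by simp
  have limX: "opX (opH n f) \<longlonglongrightarrow> 0"
    using opH_tendsto_0[OF n f(2)] abs_opX_le
    by (intro Lim_null_comparison[of "opX (opH n f)" "\<lambda>k. \<bar>opH n f k\<bar>"] always_eventually)
      (auto intro: tendsto_rabs_zero)
  \<comment> \<open>Both operators are diagonal in the coordinates of V.\<close>
  have "opZ (opH n f) = opH n (opZ f)"
    by (simp add: f(1) opH_opV[OF n] opZ_opV mult.left_commute)
  then have "opY (opH n f) = (\<lambda>k. opH n (opZ f) k - opX (opH n f) k)"
    by (simp add: opZ_def fun_eq_iff) (metis add_diff_cancel_left')
  then have "opY (opH n f) \<longlonglongrightarrow> 0"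
    using tendsto_diff[OF limZ limX] by simp
  then have "(\<lambda>N. opY (opH n f) (Suc N)) \<longlonglongrightarrow> 0"
    by (rule LIMSEQ_Suc)
  then have lim: "(\<lambda>N. 1 / (1 - q) * \<bar>opY (opH n f) (Suc N)\<bar>) \<longlonglongrightarrow> 0"
    by (intro tendsto_mult_right_zero tendsto_rabs_zero)
  show ?thesis
  proof (rule Lim_null_comparison[OF always_eventually lim], rule allI)
    fix N
    \<comment> \<open>y sums strictly below its index, so the sum up to N sits at N + 1; the factor
      [N+1] is bounded by 1 / (1 - q).\<close>
    have "(\<Sum>k\<le>N. opH n f k) = qint q (Suc N) * opY (opH n f) (Suc N)"
      using qint_pos[of "Suc N"] by (simp add: opY_def lessThan_Suc_atMost)
    then show "norm (\<Sum>k\<le>N. opH n f k) \<le> 1 / (1 - q) * \<bar>opY (opH n f) (Suc N)\<bar>"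
      using qint_le[of "Suc N"] qint_nonneg[of "Suc N"]
      by (simp add: abs_mult mult_right_mono del: times_divide_eq_left)
  qed
qed

lemma geometric_word_op: "geometric (word_op (X # u) (unit_seq 0))"
  using geometric_opX[OF poly_bounded_word_op[OF poly_bounded_unit_seq]] by simp

lemma sum_poly_op_dword_tendsto_0:
  assumes "0 < n"
  shows "(\<lambda>N. \<Sum>k\<le>N. poly_op (dword n (X # u @ [Y])) (unit_seq 0) k) \<longlonglongrightarrow> 0"
proof -
  let ?f = "word_op (X # u @ [Y]) (unit_seq 0)"
  have f: "?f = opV (tword_op (X # u) (\<lambda>_. 1))"
    using word_op_opV[of "X # u" "\<lambda>_. 1"] by (simp add: opY_unit_seq_0)
  have "poly_op (dword n (X # u @ [Y])) (unit_seq 0) = opH n ?f"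
    using poly_op_dword[OF assms, of "X # u"] unfolding f opH_opV[OF assms] by simp
  then show ?thesis
    using sum_opH_tendsto_0[OF assms f geometric_word_op] by simp
qed

end

section \<open>Truncated multiple zeta sums\<close>

definition decreasing_lists :: "nat \<Rightarrow> nat \<Rightarrow> nat list set" where
  "decreasing_lists m N = {ks. length ks = m \<and> sorted_wrt (>) ks \<and> (\<forall>k\<in>set ks. 0 < k \<and> k \<le> N)}"

lemma decreasing_lists_0 [simp]: "decreasing_lists 0 N = {[]}"
  by (auto simp: decreasing_lists_def)

text \<open>The head is the largest entry, so being strictly decreasing bounds the tail by k -
  1.\<close>

lemma decreasing_lists_Suc:
  "decreasing_lists (Suc m) N = (\<lambda>(k, ks). k # ks) ` (SIGMA k:{1..N}. decreasing_lists m (k - 1))"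
proof -
  have "ks \<in> decreasing_lists (Suc m) N \<longleftrightarrow>
      (\<exists>k js. ks = k # js \<and> k \<in> {1..N} \<and> js \<in> decreasing_lists m (k - 1))" for ks
    by (cases ks) (fastforce simp: decreasing_lists_def)+
  then show ?thesis by (auto simp: image_iff)
qed

lemma finite_decreasing_lists: "finite (decreasing_lists m N)"
  by (induction m arbitrary: N) (simp_all add: decreasing_lists_Suc)

definition zeta_term :: "real \<Rightarrow> nat list \<Rightarrow> nat list \<Rightarrow> real" where
  "zeta_term q s ks = (\<Prod>j<length s. q ^ ((s ! j - 1) * ks ! j) / qint q (ks ! j) ^ (s ! j))"

lemma zeta_term_Cons:
  "zeta_term q (a # s) (k # ks) = q ^ ((a - 1) * k) / qint q k ^ a * zeta_term q s ks"
  unfolding zeta_term_def list.size(4) add_0_right add_Suc_right prod.lessThan_Suc_shift by simp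

definition qzeta_trunc :: "real \<Rightarrow> nat list \<Rightarrow> nat \<Rightarrow> real" where
  "qzeta_trunc q s N = (\<Sum>ks\<in>decreasing_lists (length s) N. zeta_term q s ks)"

lemma qzeta_trunc_Nil [simp]: "qzeta_trunc q [] N = 1"
  by (simp add: qzeta_trunc_def zeta_term_def)

lemma qzeta_trunc_Cons:
  "qzeta_trunc q (a # s) N =
    (\<Sum>k\<in>{1..N}. q ^ ((a - 1) * k) / qint q k ^ a * qzeta_trunc q s (k - 1))"
proof -
  have "inj_on (\<lambda>(k, ks). k # ks) (SIGMA k:{1..N}. decreasing_lists (length s) (k - 1))"
    by (auto simp: inj_on_def)
  then have "qzeta_trunc q (a # s) N =
      (\<Sum>(k, ks)\<in>(SIGMA k:{1..N}. decreasing_lists (length s) (k - 1)). zeta_term q (a # s) (k # ks))"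
    unfolding qzeta_trunc_def
    by (simp add: decreasing_lists_Suc sum.reindex case_prod_unfold del: One_nat_def)
  also have "\<dots> = (\<Sum>k\<in>{1..N}. \<Sum>ks\<in>decreasing_lists (length s) (k - 1). zeta_term q (a # s) (k # ks))"
    by (rule sum.Sigma[symmetric]) (auto simp: finite_decreasing_lists)
  finally show ?thesis
    by (simp add: zeta_term_Cons sum_distrib_left qzeta_trunc_def)
qed

section \<open>Zeta values as limits of operator sums\<close>

context q_param
begin

lemma word_op_at_0: "w \<noteq> [] \<Longrightarrow> word_op w f 0 = 0"
proof (cases w)
  case (Cons a v)
  then show "word_op w f 0 = 0"
    by (cases a) (simp_all add: opX_def opY_def)
qed simp

text \<open>The power p^c stores the x's already read. At the next y it joins the division by [k] as
  q^(ck) / [k]^(c+1), the factor of exponent c + 1.\<close>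

lemma sum_word_op_pending:
  assumes "w \<noteq> []" "last w = Y"
  shows "(\<Sum>k\<in>{1..N}. p k ^ c * word_op w (unit_seq 0) k) = qzeta_trunc q (idx w c) N"
  using assms
proof (induction w arbitrary: c N)
  case (Cons a w)
  show ?case
  proof (cases a)
    case X
    with Cons.prems have "w \<noteq> []" "last w = Y" by (auto split: if_splits)
    with Cons.IH[of "Suc c" N] X show ?thesis
      by (simp add: opX_def mult_ac)
  next
    case Y
    have "(\<Sum>j<k. word_op w (unit_seq 0) j) = qzeta_trunc q (idx w 0) (k - 1)" if "k \<in> {1..N}" for k
    proof (cases "w = []")
      case True
      \<comment> \<open>Since k \<ge> 1, the sum below k contains index 0 and equals 1, the value of
        the empty zeta sum.\<close>
      then show ?thesis using that by (simp add: unit_seq_def)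
    next
      case False
      have "(\<Sum>j<k. word_op w (unit_seq 0) j) = (\<Sum>j\<in>{1..k - 1}. word_op w (unit_seq 0) j)"
        using False by (intro sum.mono_neutral_right) (auto simp: Suc_le_eq word_op_at_0)
      then show ?thesis
        using Cons.IH[of 0 "k - 1"] Cons.prems False by simp
    qed
    moreover have "p k ^ c * (x / qint q k) = q ^ (c * k) / qint q k ^ Suc c * x" for k x
      by (simp add: p_def power_divide power_mult[symmetric] mult.commute[of k])
    ultimately show ?thesis
      unfolding Y by (simp add: qzeta_trunc_Cons opY_def del: power_Suc One_nat_def)
  qed
qed simp

lemma sum_word_op:
  assumes "w \<noteq> []" "last w = Y"
  shows "(\<Sum>k\<le>N. word_op w (unit_seq 0) k) = qzeta_trunc q (idx w 0) N"
proof -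
  have "(\<Sum>k\<le>N. word_op w (unit_seq 0) k) = (\<Sum>k\<in>{1..N}. word_op w (unit_seq 0) k)"
    using assms by (intro sum.mono_neutral_right) (auto simp: Suc_le_eq word_op_at_0)
  then show ?thesis
    using sum_word_op_pending[OF assms, of 0 N] by simp
qed

lemma qzeta_eqI:
  assumes "qzeta_trunc q s \<longlonglongrightarrow> l"
  shows "qzeta q s = l"
proof -
  let ?A = "{ks. length ks = length s \<and> sorted_wrt (>) ks \<and> (\<forall>k\<in>set ks. k > 0)}"
  have "(zeta_term q s has_sum l) ?A"
  proof (rule has_sum_exhaustion[where B = "decreasing_lists (length s)"])
    show "zeta_term q s ks \<ge> 0" for ks
      using q_pos qint_nonneg by (auto simp: zeta_term_def intro!: prod_nonneg)
    show "mono (decreasing_lists (length s))"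
      by (force simp: mono_def decreasing_lists_def)
    show "\<exists>N. F \<subseteq> decreasing_lists (length s) N" if "finite F" "F \<subseteq> ?A" for F
    proof
      \<comment> \<open>The largest entry occurring in F serves as truncation level.\<close>
      have "k \<le> Max (\<Union>ks\<in>F. set ks)" if "ks \<in> F" "k \<in> set ks" for k ks
        using \<open>finite F\<close> that by (intro Max_ge) auto
      then show "F \<subseteq> decreasing_lists (length s) (Max (\<Union>ks\<in>F. set ks))"
        using that(2) by (auto simp: decreasing_lists_def)
    qed
    show "decreasing_lists (length s) N \<subseteq> ?A" for N
      by (auto simp: decreasing_lists_def)
  qed (use assms in \<open>simp_all add: finite_decreasing_lists qzeta_trunc_def[abs_def]\<close>)
  then have "infsum (zeta_term q s) ?A = l" by (rule infsumI)
  then show ?thesis by (simp add: qzeta_def zeta_term_def[abs_def])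
qed

text \<open>The leading x makes the entries decay geometrically, so the partial sums converge; being
  truncated zeta sums, they have the zeta value as limit.\<close>

lemma sum_word_op_tendsto_qzeta:
  assumes "w \<noteq> []" "hd w = X" "last w = Y"
  shows "(\<lambda>N. \<Sum>k\<le>N. word_op w (unit_seq 0) k) \<longlonglongrightarrow> qzeta q (idx w 0)"
proof -
  have "summable (word_op w (unit_seq 0))"
    using assms geometric_summable[OF geometric_word_op[of "tl w"]] by (cases w) simp_all
  then have lim: "(\<lambda>N. \<Sum>k\<le>N. word_op w (unit_seq 0) k) \<longlonglongrightarrow> suminf (word_op w (unit_seq 0))"
    by (rule summable_LIMSEQ')
  then have "qzeta_trunc q (idx w 0) \<longlonglongrightarrow> suminf (word_op w (unit_seq 0))"
    by (simp add: sum_word_op assms)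
  with lim show ?thesis by (simp add: qzeta_eqI)
qed

text \<open>A derived word has finite support, so the truncated sums pass to the zeta values
  termwise. Exchanging the two finite sums shows them to be the partial sums that tend to 0.\<close>

lemma lin_ext_qzeta_dword:
  assumes "0 < n" "w = [] \<or> (w \<noteq> [] \<and> hd w = X \<and> last w = Y)"
  shows "lin_ext (\<lambda>v. qzeta q (idx v 0)) (dword n w) = 0"
proof (cases "w = []")
  case True
  then show ?thesis by (simp add: lin_ext_def supp_def)
next
  case False
  \<comment> \<open>The first and last letters differ, so the word has at least two letters.\<close>
  with assms obtain u where w: "w = X # u @ [Y]"
    by (metis append_butlast_last_id hd_Cons_tl last_ConsL last_tl letter.distinct(1))
  let ?S = "\<lambda>N v. \<Sum>k\<le>N. word_op v (unit_seq 0) k"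
  have "(\<lambda>N. lin_ext (?S N) (dword n w)) \<longlonglongrightarrow> lin_ext (\<lambda>v. qzeta q (idx v 0)) (dword n w)"
  proof (rule tendsto_lin_ext)
    fix v assume v: "v \<in> supp (dword n w)"
    show "(\<lambda>N. ?S N v) \<longlonglongrightarrow> qzeta q (idx v 0)"
      using last_supp_dword[OF v] hd_supp_dword[OF v] w
      by (intro sum_word_op_tendsto_qzeta) auto
  qed
  moreover have "lin_ext (?S N) P = (\<Sum>k\<le>N. poly_op P (unit_seq 0) k)" for N P
    unfolding lin_ext_def poly_op_def sum_distrib_left by (rule sum.swap)
  ultimately show ?thesis
    using sum_poly_op_dword_tendsto_0[OF assms(1), of u] LIMSEQ_unique unfolding w by fastforce
qed

end

theorem theorem4p1:
  fixes q :: real and n :: nat and w :: ncpoly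
  assumes "0 < q" and "q < 1" and "0 < n" and "in_h0 w"
  shows "zhat q (dn n w) = 0"
proof -
  interpret q_param q using assms by unfold_locales
  have "zhat q (dn n w) = lin_ext (\<lambda>v. qzeta q (idx v 0)) (dn n w)"
    by (simp add: zhat_def lin_ext_def)
  also have "\<dots> = (\<Sum>v\<in>supp w. of_rat (w v) * lin_ext (\<lambda>v. qzeta q (idx v 0)) (dword n v))"
    unfolding dn_def using assms(4) by (intro lin_ext_sum finite_supp_dword) (simp add: in_h0_def in_h_def)
  also have "\<dots> = 0"
    using assms(3,4) by (intro sum.neutral) (simp add: in_h0_def lin_ext_qzeta_dword)
  finally show ?thesis .
qed

end
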